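(* Let $A:L^1(\Omega)\to L^\infty(\Gamma)$, $f$, $f^\delta$, $R$, $H_{f^\delta}$, $u^\dagger$ and $u_\alpha^\delta$ ($\alpha,\delta>0$) be as in the context. Assume that the following source condition holds: there exist $p^\dagger\in L^\infty(\Gamma)$ and $v^\dagger\in L^1(\Omega)$ such that $$A^*p^\dagger\in\partial R(u^\dagger)\quad\text{and}\quad f p^\dagger=Av^\dagger .$$ Assume that $Au_\alpha^\delta\in E$ for any $\alpha,\delta>0$, and that there exists $m>0$ with $m\le\inf\{\operatorname{ess\,inf}Au_\alpha^\delta:\alpha,\delta>0,\ \alpha,\delta\text{ sufficiently small}\}$. Then, for all sufficiently small $\alpha,\delta>0$, $$D_R(u_\alpha^\delta,u^\dagger)\le D_R(u^\dagger-\alpha v^\dagger,u^\dagger)+\frac{\delta^2}{\alpha}\cdot\frac{\mu(\Gamma)}{\gamma}+\alpha\delta^2\cdot\frac{\Vert p^\dagger\Vert_2^2}{\gamma}+\alpha^3\cdot\frac{\Vert f(p^\dagger)^2\Vert_2^2}{\gamma}+\alpha^3\delta^2\cdot\frac{\Vert(p^\dagger)^2\Vert_2^2}{\gamma},$$ where $\mu(\Gamma)$ is the Lebesgue measure of $\Gamma$ and $\gamma=\frac{2m}{3}$.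
   Context: $\Omega,\Gamma\subset\mathbb{R}^2$ are bounded measurable sets. $A:L^1(\Omega)\to L^\infty(\Gamma)$ is linear, compact and ill-posed (i.e. the equation $Au=f$ is ill-posed). The exact data $f\in L^\infty(\Gamma)$ are not known; for each $\delta>0$ one has noisy data $f^\delta\in L^\infty(\Gamma)$, $f^\delta\ge0$, with $\Vert f-f^\delta\Vert_\infty\le\delta$, and there are constants $C_1,C_2>0$ independent of $\delta$ such that $C_1<f^\delta(t)<C_2$ for a.e. $t\in\Gamma$. The data fidelity is the Kullback-Leibler functional $H_{f^\delta}:L^\infty(\Gamma)\to[0,+\infty]$, $H_{f^\delta}(z)=\int_\Gamma\varphi_{f^\delta}(t,z(t))\,dt$ if $z\ge0$ a.e. and $z\ln z\in L^1(\Gamma)$, and $H_{f^\delta}(z)=+\infty$ otherwise, where $\varphi_{f^\delta}(t,\tau)=f^\delta(t)\ln\frac{f^\delta(t)}{\tau}-f^\delta(t)+\tau$ for $\tau>0$ and $\varphi_{f^\delta}(t,\tau)=+\infty$ for $\tau\le0$. $R:L^1(\Omega)\to\mathbb{R}\cup\{+\infty\}$ is proper, convex and lower semicontinuous. $u^\dagger\in\operatorname{arg\,min}\{R(u):Au=f\}$. For all $\alpha,\delta>0$ it is assumed that a minimizer $u_\alpha^\delta$ of $\frac1\alpha H_{f^\delta}(Au)+R(u)$ over $u\in L^1(\Omega)$ exists, and that there is $u_0\in\operatorname{dom}(H_{f^\delta}\circ A)\cap\operatorname{dom}R$ such that $H_{f^\delta}$ is continuous at $Au_0$. $E=\{v\in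 L^1(\Gamma):0<\operatorname{ess\,inf}v\le\operatorname{ess\,sup}v<+\infty\}$. An element $p\in L^\infty(\Gamma)$ is regarded as the element $z\mapsto\int_\Gamma pz\,dt$ of $(L^\infty(\Gamma))^*$. Products and powers of functions are pointwise; $\Vert\cdot\Vert_2$ is the $L^2(\Gamma)$-norm. $D_R(u,u^\dagger)=R(u)-R(u^\dagger)-\langle A^*p^\dagger,u-u^\dagger\rangle$ is the Bregman distance with respect to $R$ and the subgradient $A^*p^\dagger\in\partial R(u^\dagger)$. *)

theory Defs
  imports "HOL-Analysis.Analysis" "HOL-Probability.Essential_Supremum"
begin

text \<open>
  Elements of \<open>L\<^sup>1\<close> and \<open>L\<^sup>\<infinity>\<close> are represented by functions, not by equivalence classes:
  identities between elements are stated almost everywhere, and operators and functionals on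
  these spaces are required to respect almost-everywhere equality.
\<close>

definition L1_space :: "'a measure \<Rightarrow> ('a \<Rightarrow> real) set" where
  "L1_space M = {u. integrable M u}"

definition L1_norm :: "'a measure \<Rightarrow> ('a \<Rightarrow> real) \<Rightarrow> real" where
  "L1_norm M u = (\<integral>x. \<bar>u x\<bar> \<partial>M)"

definition L2_norm :: "'a measure \<Rightarrow> ('a \<Rightarrow> real) \<Rightarrow> real" where
  "L2_norm M u = sqrt (\<integral>x. (u x)\<^sup>2 \<partial>M)"

definition Linf_space :: "'a measure \<Rightarrow> ('a \<Rightarrow> real) set" where
  "Linf_space M = {z \<in> borel_measurable M. esssup M (\<lambda>x. ereal \<bar>z x\<bar>) < \<infinity>}"

definition Linf_norm :: "'a measure \<Rightarrow> ('a \<Rightarrow> real) \<Rightarrow> real" where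
  "Linf_norm M z = real_of_ereal (esssup M (\<lambda>x. ereal \<bar>z x\<bar>))"

definition essinf :: "'a measure \<Rightarrow> ('a \<Rightarrow> real) \<Rightarrow> ereal" where
  "essinf M v = - esssup M (\<lambda>x. - ereal (v x))"

definition E_set :: "'a measure \<Rightarrow> ('a \<Rightarrow> real) set" where
  "E_set M = {v \<in> L1_space M. 0 < essinf M v \<and> essinf M v \<le> esssup M (\<lambda>x. ereal (v x))
                \<and> esssup M (\<lambda>x. ereal (v x)) < \<infinity>}"


text \<open>
  The topology of a (semi)normed function space.  It does not separate functions that agree
  almost everywhere; its open sets are the preimages of the open sets of the space of classes.
\<close>

definition norm_topology ::
    "('a \<Rightarrow> real) set \<Rightarrow> (('a \<Rightarrow> real) \<Rightarrow> real) \<Rightarrow> ('a \<Rightarrow> real) topology" where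
  "norm_topology V N = topology (\<lambda>U. U \<subseteq> V \<and>
     (\<forall>u\<in>U. \<exists>\<epsilon>>0. \<forall>w\<in>V. N (\<lambda>x. w x - u x) < \<epsilon> \<longrightarrow> w \<in> U))"

lemma openin_norm_topology:
  "openin (norm_topology V N) U \<longleftrightarrow>
     U \<subseteq> V \<and> (\<forall>u\<in>U. \<exists>\<epsilon>>0. \<forall>w\<in>V. N (\<lambda>x. w x - u x) < \<epsilon> \<longrightarrow> w \<in> U)"
proof -
  let ?P = "\<lambda>U. U \<subseteq> V \<and> (\<forall>u\<in>U. \<exists>\<epsilon>>0. \<forall>w\<in>V. N (\<lambda>x. w x - u x) < \<epsilon> \<longrightarrow> w \<in> U)"
  have "istopology ?P"
    unfolding istopology_def
  proof (intro conjI allI impI)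
    fix S T assume S: "?P S" and T: "?P T"
    show "S \<inter> T \<subseteq> V" using S by blast
    show "\<forall>u\<in>S \<inter> T. \<exists>\<epsilon>>0. \<forall>w\<in>V. N (\<lambda>x. w x - u x) < \<epsilon> \<longrightarrow> w \<in> S \<inter> T"
    proof
      fix u assume u: "u \<in> S \<inter> T"
      obtain a where a: "a > 0" "\<forall>w\<in>V. N (\<lambda>x. w x - u x) < a \<longrightarrow> w \<in> S" using S u by blast
      obtain b where b: "b > 0" "\<forall>w\<in>V. N (\<lambda>x. w x - u x) < b \<longrightarrow> w \<in> T" using T u by blast
      show "\<exists>\<epsilon>>0. \<forall>w\<in>V. N (\<lambda>x. w x - u x) < \<epsilon> \<longrightarrow> w \<in> S \<inter> T"
        using a b by (intro exI[of _ "min a b"]) auto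
    qed
  next
    fix K assume K: "\<forall>S\<in>K. ?P S"
    show "\<Union>K \<subseteq> V" using K by blast
    show "\<forall>u\<in>\<Union>K. \<exists>\<epsilon>>0. \<forall>w\<in>V. N (\<lambda>x. w x - u x) < \<epsilon> \<longrightarrow> w \<in> \<Union>K"
      using K by (metis UnionE UnionI)
  qed
  then show ?thesis
    unfolding norm_topology_def by (simp add: topology_inverse')
qed

abbreviation L1_top :: "'a measure \<Rightarrow> ('a \<Rightarrow> real) topology" where
  "L1_top M \<equiv> norm_topology (L1_space M) (L1_norm M)"

abbreviation Linf_top :: "'a measure \<Rightarrow> ('a \<Rightarrow> real) topology" where
  "Linf_top M \<equiv> norm_topology (Linf_space M) (Linf_norm M)"


definition linear_operator ::
    "'a measure \<Rightarrow> 'b measure \<Rightarrow> (('a \<Rightarrow> real) \<Rightarrow> 'b \<Rightarrow> real) \<Rightarrow> bool" where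
  "linear_operator M N A \<longleftrightarrow>
     (\<forall>u\<in>L1_space M. A u \<in> Linf_space N) \<and>
     (\<forall>u\<in>L1_space M. \<forall>w\<in>L1_space M.
        (AE x in M. u x = w x) \<longrightarrow> (AE t in N. A u t = A w t)) \<and>
     (\<forall>u\<in>L1_space M. \<forall>w\<in>L1_space M. \<forall>a b.
        AE t in N. A (\<lambda>x. a * u x + b * w x) t = a * A u t + b * A w t)"

definition compact_operator ::
    "'a measure \<Rightarrow> 'b measure \<Rightarrow> (('a \<Rightarrow> real) \<Rightarrow> 'b \<Rightarrow> real) \<Rightarrow> bool" where
  "compact_operator M N A \<longleftrightarrow>
     (\<forall>B. B \<subseteq> L1_space M \<and> (\<exists>c. \<forall>u\<in>B. L1_norm M u \<le> c) \<longrightarrow>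
        compactin (Linf_top N) (Linf_top N closure_of (A ` B)))"

text \<open>
  Well-posedness in the sense of Hadamard: for all data a solution exists, it is unique, and it
  depends continuously on the data.  Ill-posedness is the negation.
\<close>

definition well_posed ::
    "'a measure \<Rightarrow> 'b measure \<Rightarrow> (('a \<Rightarrow> real) \<Rightarrow> 'b \<Rightarrow> real) \<Rightarrow> bool" where
  "well_posed M N A \<longleftrightarrow>
     (\<exists>S. (\<forall>g\<in>Linf_space N. S g \<in> L1_space M \<and> (AE t in N. A (S g) t = g t) \<and>
             (\<forall>u\<in>L1_space M. (AE t in N. A u t = g t) \<longrightarrow> (AE x in M. u x = S g x))) \<and>
          continuous_map (Linf_top N) (L1_top M) S)"


definition dual_space ::
    "('a \<Rightarrow> real) set \<Rightarrow> (('a \<Rightarrow> real) \<Rightarrow> real) \<Rightarrow> (('a \<Rightarrow> real) \<Rightarrow> real) set" where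
  "dual_space V N = {\<xi>.
     (\<forall>u\<in>V. \<forall>w\<in>V. \<forall>a b. \<xi> (\<lambda>x. a * u x + b * w x) = a * \<xi> u + b * \<xi> w) \<and>
     (\<exists>C. \<forall>u\<in>V. \<bar>\<xi> u\<bar> \<le> C * N u)}"

definition dual_of :: "'a measure \<Rightarrow> ('a \<Rightarrow> real) \<Rightarrow> ('a \<Rightarrow> real) \<Rightarrow> real" where
  "dual_of M p = (\<lambda>z. \<integral>t. p t * z t \<partial>M)"

definition adjoint_operator ::
    "(('a \<Rightarrow> real) \<Rightarrow> 'b \<Rightarrow> real) \<Rightarrow> (('b \<Rightarrow> real) \<Rightarrow> real) \<Rightarrow> ('a \<Rightarrow> real) \<Rightarrow> real" where
  "adjoint_operator A \<xi> = (\<lambda>u. \<xi> (A u))"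


definition proper_functional :: "'a measure \<Rightarrow> (('a \<Rightarrow> real) \<Rightarrow> ereal) \<Rightarrow> bool" where
  "proper_functional M R \<longleftrightarrow>
     (\<forall>u\<in>L1_space M. \<forall>w\<in>L1_space M. (AE x in M. u x = w x) \<longrightarrow> R u = R w) \<and>
     (\<forall>u\<in>L1_space M. R u \<noteq> -\<infinity>) \<and>
     (\<exists>u\<in>L1_space M. R u \<noteq> \<infinity>)"

definition convex_functional :: "'a measure \<Rightarrow> (('a \<Rightarrow> real) \<Rightarrow> ereal) \<Rightarrow> bool" where
  "convex_functional M R \<longleftrightarrow>
     (\<forall>u\<in>L1_space M. \<forall>w\<in>L1_space M. \<forall>a\<ge>0. \<forall>b\<ge>0. a + b = 1 \<longrightarrow>
        R (\<lambda>x. a * u x + b * w x) \<le> ereal a * R u + ereal b * R w)"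

definition lsc_functional :: "'a measure \<Rightarrow> (('a \<Rightarrow> real) \<Rightarrow> ereal) \<Rightarrow> bool" where
  "lsc_functional M R \<longleftrightarrow> (\<forall>c. openin (L1_top M) {u \<in> L1_space M. c < R u})"

definition subdifferential ::
    "'a measure \<Rightarrow> (('a \<Rightarrow> real) \<Rightarrow> ereal) \<Rightarrow> ('a \<Rightarrow> real) \<Rightarrow> (('a \<Rightarrow> real) \<Rightarrow> real) set" where
  "subdifferential M R u =
     {\<xi> \<in> dual_space (L1_space M) (L1_norm M).
        \<forall>w\<in>L1_space M. R u + ereal (\<xi> (\<lambda>x. w x - u x)) \<le> R w}"

definition bregman ::
    "(('a \<Rightarrow> real) \<Rightarrow> ereal) \<Rightarrow> (('a \<Rightarrow> real) \<Rightarrow> real) \<Rightarrow> ('a \<Rightarrow> real) \<Rightarrow> ('a \<Rightarrow> real) \<Rightarrow> ereal" where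
  "bregman R \<xi> u w = R u - R w - ereal (\<xi> (\<lambda>x. u x - w x))"


definition kl_integrand :: "real \<Rightarrow> real \<Rightarrow> ereal" where
  "kl_integrand a \<tau> = (if \<tau> > 0 then ereal (a * ln (a / \<tau>) - a + \<tau>) else \<infinity>)"

text \<open>
  For \<open>g \<ge> 0\<close> the integrand is nonnegative, so that \<open>e2ennreal\<close> does not truncate.
  The convention \<open>0 ln 0 = 0\<close> is built into \<open>ln 0 = 0\<close>.
\<close>

definition KL :: "'a measure \<Rightarrow> ('a \<Rightarrow> real) \<Rightarrow> ('a \<Rightarrow> real) \<Rightarrow> ereal" where
  "KL M g z =
     (if (AE t in M. 0 \<le> z t) \<and> integrable M (\<lambda>t. z t * ln (z t))
      then enn2ereal (\<integral>\<^sup>+t. e2ennreal (kl_integrand (g t) (z t)) \<partial>M)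
      else \<infinity>)"

end

theory Submission
  imports Defs
begin

text \<open>
  Write \<open>z = A u\<close> for a minimizer \<open>u\<close>, \<open>g\<close> for the noisy data, \<open>w = u\<^sup>\<dagger> - \<alpha> v\<^sup>\<dagger>\<close> for the
  comparison element and \<open>s = \<alpha> p\<^sup>\<dagger>\<close>.  The source condition turns the image of \<open>w\<close> into an
  explicit perturbation of the exact data, \<open>A w = f (1 - s)\<close>.

  Two ingredients are combined.  First, the Kullback-Leibler functional is differentiable at \<open>z\<close>
  in bounded directions because \<open>z\<close> is bounded away from \<open>0\<close>, with derivative \<open>1 - g / z\<close>.
  Minimality of \<open>u\<close>, tested along the segment from \<open>u\<close> to \<open>w\<close> and combined with the convexity of
  \<open>R\<close>, therefore gives (lemma \<open>variational_inequality\<close>)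
  \<open>R u - R w \<le> (1 / \<alpha>) \<integral> (1 - g / z) (A w - z)\<close>.
  In the difference of the Bregman distances of \<open>u\<close> and \<open>w\<close> to \<open>u\<^sup>\<dagger>\<close> the value \<open>R u\<^sup>\<dagger>\<close> cancels
  and the adjoint contributes \<open>\<integral> p\<^sup>\<dagger> (A w - z)\<close>, so that this difference is at most
  \<open>\<integral> X ((1 - g / z) / \<alpha> + p\<^sup>\<dagger>)\<close> with \<open>X = A w - z\<close>.

  Second, this integrand is bounded pointwise (lemma \<open>residual_product_le\<close>).  Its factors
  \<open>X = f (1 - s) - z\<close> and \<open>z (1 + s) - g\<close> are almost opposite to each other: the second one equals
  \<open>Q - (1 + s) X\<close> with the small remainder \<open>Q = (f - g) - f s\<^sup>2\<close>.  The integrand is thus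
  \<open>(X Q - (1 + s) X\<^sup>2) / (\<alpha> z)\<close>, and the negative square absorbs \<open>X\<close> by Young's inequality as soon
  as \<open>\<bar>s\<bar> \<le> 1 / 2\<close>.  What is left is of order \<open>Q\<^sup>2 / (\<alpha> m)\<close>, that is, \<open>\<delta>\<^sup>2 / \<alpha>\<close> from the noise
  and \<open>\<alpha>\<^sup>3\<close> from \<open>f s\<^sup>2\<close>.  This argument also determines how small \<open>\<alpha>\<close> has to be:
  \<open>\<alpha> \<parallel>p\<^sup>\<dagger>\<parallel>\<^sub>\<infinity> \<le> 1 / 2\<close>, together with the range in which \<open>z \<ge> m\<close> is known.
\<close>

section \<open>Essentially bounded functions\<close>

text \<open>
  Membership as a plain almost-everywhere bound: all integrability questions below reduce to
  checking that a function is bounded on a finite measure space.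
\<close>

lemma Linf_space_iff:
  "z \<in> Linf_space M \<longleftrightarrow> z \<in> borel_measurable M \<and> (\<exists>K. AE t in M. \<bar>z t\<bar> \<le> K)"
proof
  assume z: "z \<in> Linf_space M"
  then have m: "z \<in> borel_measurable M" and fin: "esssup M (\<lambda>x. ereal \<bar>z x\<bar>) < \<infinity>"
    by (auto simp: Linf_space_def)
  obtain K where K: "esssup M (\<lambda>x. ereal \<bar>z x\<bar>) \<le> ereal K"
    using fin by (cases "esssup M (\<lambda>x. ereal \<bar>z x\<bar>)") auto
  have "AE t in M. ereal \<bar>z t\<bar> \<le> esssup M (\<lambda>x. ereal \<bar>z x\<bar>)"
    by (rule esssup_AE)
  then have "AE t in M. \<bar>z t\<bar> \<le> K"
    by eventually_elim (use K in \<open>metis ereal_less_eq(3) order_trans\<close>)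
  then show "z \<in> borel_measurable M \<and> (\<exists>K. AE t in M. \<bar>z t\<bar> \<le> K)"
    using m by blast
next
  assume "z \<in> borel_measurable M \<and> (\<exists>K. AE t in M. \<bar>z t\<bar> \<le> K)"
  then obtain K where m: "z \<in> borel_measurable M" and K: "AE t in M. \<bar>z t\<bar> \<le> K" by blast
  have "esssup M (\<lambda>x. ereal \<bar>z x\<bar>) \<le> ereal K"
    by (rule esssup_I) (use m K in auto)
  also have "\<dots> < \<infinity>" by simp
  finally show "z \<in> Linf_space M" using m by (simp add: Linf_space_def)
qed

lemma Linf_spaceI: "z \<in> borel_measurable M \<Longrightarrow> AE t in M. \<bar>z t\<bar> \<le> K \<Longrightarrow> z \<in> Linf_space M"
  by (auto simp: Linf_space_iff)

lemma Linf_space_measurable: "z \<in> Linf_space M \<Longrightarrow> z \<in> borel_measurable M"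
  by (simp add: Linf_space_iff)

lemma Linf_space_boundE:
  assumes "z \<in> Linf_space M"
  obtains K where "K > 0" "AE t in M. \<bar>z t\<bar> \<le> K"
proof -
  obtain K where K: "AE t in M. \<bar>z t\<bar> \<le> K" using assms by (auto simp: Linf_space_iff)
  then have "AE t in M. \<bar>z t\<bar> \<le> max K 1" by eventually_elim auto
  then show ?thesis using that[of "max K 1"] by simp
qed

lemma Linf_space_add:
  assumes "y \<in> Linf_space M" "z \<in> Linf_space M"
  shows "(\<lambda>t. y t + z t) \<in> Linf_space M"
proof -
  obtain K L where "AE t in M. \<bar>y t\<bar> \<le> K" "AE t in M. \<bar>z t\<bar> \<le> L"
    using assms by (auto simp: Linf_space_iff)
  then have "AE t in M. \<bar>y t + z t\<bar> \<le> K + L" by eventually_elim linarith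
  then show ?thesis
    by (rule Linf_spaceI[rotated]) (intro borel_measurable_add Linf_space_measurable assms)
qed

lemma Linf_space_mult:
  assumes "y \<in> Linf_space M" "z \<in> Linf_space M"
  shows "(\<lambda>t. y t * z t) \<in> Linf_space M"
proof -
  obtain K L where "AE t in M. \<bar>y t\<bar> \<le> K" "AE t in M. \<bar>z t\<bar> \<le> L"
    using assms by (auto simp: Linf_space_iff)
  then have "AE t in M. \<bar>y t * z t\<bar> \<le> K * L"
  proof eventually_elim
    case (elim t)
    then have "0 \<le> K" by linarith
    with elim show ?case unfolding abs_mult by (intro mult_mono) auto
  qed
  then show ?thesis
    by (rule Linf_spaceI[rotated]) (intro borel_measurable_times Linf_space_measurable assms)
qed

lemma Linf_space_const: "(\<lambda>t. c) \<in> Linf_space M"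
  by (rule Linf_spaceI[of _ _ "\<bar>c\<bar>"]) auto

lemma Linf_space_diff:
  assumes "y \<in> Linf_space M" "z \<in> Linf_space M"
  shows "(\<lambda>t. y t - z t) \<in> Linf_space M"
  using Linf_space_add[OF assms(1) Linf_space_mult[OF Linf_space_const[of "-1"] assms(2)]]
  by simp

lemma Linf_space_power:
  assumes "z \<in> Linf_space M"
  shows "(\<lambda>t. z t ^ n) \<in> Linf_space M"
  by (induction n) (simp_all add: Linf_space_const Linf_space_mult assms)

lemma Linf_space_inverse:
  assumes "z \<in> Linf_space M" "c > 0" "AE t in M. c \<le> z t"
  shows "(\<lambda>t. inverse (z t)) \<in> Linf_space M"
proof (rule Linf_spaceI)
  show "AE t in M. \<bar>inverse (z t)\<bar> \<le> inverse c"
    using assms(3) by eventually_elim (use assms(2) in \<open>simp add: le_imp_inverse_le\<close>)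
qed (use assms(1) in \<open>intro borel_measurable_inverse Linf_space_measurable\<close>)

lemma Linf_space_divide:
  assumes "y \<in> Linf_space M" "z \<in> Linf_space M" "c > 0" "AE t in M. c \<le> z t"
  shows "(\<lambda>t. y t / z t) \<in> Linf_space M"
  using Linf_space_mult[OF assms(1) Linf_space_inverse[OF assms(2-4)]]
  by (simp add: divide_inverse)

lemma Linf_space_ln:
  assumes "z \<in> Linf_space M" "c > 0" "AE t in M. c \<le> z t"
  shows "(\<lambda>t. ln (z t)) \<in> Linf_space M"
proof -
  obtain K where K: "K > 0" "AE t in M. \<bar>z t\<bar> \<le> K" by (rule Linf_space_boundE[OF assms(1)])
  show ?thesis
  proof (rule Linf_spaceI)
    show "AE t in M. \<bar>ln (z t)\<bar> \<le> \<bar>ln c\<bar> + \<bar>ln K\<bar>"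
      using K(2) assms(3)
    proof eventually_elim
      case (elim t)
      then have "ln c \<le> ln (z t)" "ln (z t) \<le> ln K" using assms(2) K(1) by auto
      then show ?case by linarith
    qed
  qed (use assms(1) in \<open>intro borel_measurable_ln Linf_space_measurable\<close>)
qed

lemmas Linf_space_intros =
  Linf_space_add Linf_space_mult Linf_space_diff Linf_space_power Linf_space_const

lemma (in finite_measure) Linf_space_integrable:
  assumes "z \<in> Linf_space M"
  shows "integrable M z"
proof -
  obtain K where "AE t in M. \<bar>z t\<bar> \<le> K" using assms by (auto simp: Linf_space_iff)
  then show ?thesis
    using assms by (intro integrable_const_bound[of _ K]) (auto simp: Linf_space_iff)
qed

lemma AE_abs_le_Linf_norm:
  assumes "z \<in> Linf_space M"
  shows "AE t in M. \<bar>z t\<bar> \<le> Linf_norm M z"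
proof -
  have fin: "esssup M (\<lambda>x. ereal \<bar>z x\<bar>) < \<infinity>" using assms by (simp add: Linf_space_def)
  have "AE t in M. ereal \<bar>z t\<bar> \<le> esssup M (\<lambda>x. ereal \<bar>z x\<bar>)" by (rule esssup_AE)
  then show ?thesis
    unfolding Linf_norm_def
    by eventually_elim (use fin in \<open>cases "esssup M (\<lambda>x. ereal \<bar>z x\<bar>)"; simp\<close>)
qed

lemma AE_essinf_le:
  assumes "ereal c \<le> essinf M v"
  shows "AE t in M. c \<le> v t"
proof -
  have "AE t in M. - ereal (v t) \<le> esssup M (\<lambda>x. - ereal (v x))" by (rule esssup_AE)
  then show ?thesis
  proof eventually_elim
    case (elim t)
    then have "essinf M v \<le> ereal (v t)"
      unfolding essinf_def using ereal_uminus_le_reorder by blast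
    then show ?case using assms by (metis ereal_less_eq(3) order_trans)
  qed
qed

section \<open>The Kullback-Leibler functional along a segment\<close>

text \<open>
  Nonnegativity of the Kullback-Leibler integrand, which is what allows passing from the
  extended nonnegative integral in its definition to a Lebesgue integral.
\<close>

lemma kl_term_nonneg:
  fixes a \<tau> :: real
  assumes "0 < a" "0 < \<tau>"
  shows "0 \<le> a * ln (a / \<tau>) - a + \<tau>"
proof -
  have "ln (\<tau> / a) \<le> \<tau> / a - 1" using assms by (intro ln_le_minus_one) auto
  then have "a * ln (\<tau> / a) \<le> \<tau> - a" using assms by (simp add: field_simps)
  moreover have "ln (a / \<tau>) = - ln (\<tau> / a)" using assms by (simp add: ln_div)
  ultimately show ?thesis by simp
qed

lemma KL_integrand_Linf:
  assumes "g \<in> Linf_space M" "b > 0" "AE t in M. b \<le> g t"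
    and "z \<in> Linf_space M" "c > 0" "AE t in M. c \<le> z t"
  shows "(\<lambda>t. g t * ln (g t / z t) - g t + z t) \<in> Linf_space M"
proof -
  \<comment> \<open>Splitting the logarithm reduces the claim to the boundedness of \<open>ln g\<close> and \<open>ln z\<close>.\<close>
  have "(\<lambda>t. g t * (ln (g t) - ln (z t)) - g t + z t) \<in> Linf_space M"
    by (intro Linf_space_intros Linf_space_ln[OF assms(1-3)] Linf_space_ln[OF assms(4-6)] assms)
  then obtain K where K: "AE t in M. \<bar>g t * (ln (g t) - ln (z t)) - g t + z t\<bar> \<le> K"
    by (auto simp: Linf_space_iff)
  have "AE t in M. \<bar>g t * ln (g t / z t) - g t + z t\<bar> \<le> K"
    using K assms(3,6) by eventually_elim (use assms(2,5) in \<open>simp add: ln_div\<close>)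
  moreover have "(\<lambda>t. g t * ln (g t / z t) - g t + z t) \<in> borel_measurable M"
    using assms(1,4)[THEN Linf_space_measurable] by measurable
  ultimately show ?thesis by (rule Linf_spaceI[rotated])
qed

lemma (in finite_measure) KL_eq_integral:
  assumes "g \<in> Linf_space M" "b > 0" "AE t in M. b \<le> g t"
    and "z \<in> Linf_space M" "c > 0" "AE t in M. c \<le> z t"
  shows "KL M g z = ereal (\<integral>t. g t * ln (g t / z t) - g t + z t \<partial>M)"
proof -
  let ?k = "\<lambda>t. g t * ln (g t / z t) - g t + z t"
  have k: "integrable M ?k" by (intro Linf_space_integrable KL_integrand_Linf[OF assms])
  have nn: "AE t in M. 0 \<le> ?k t"
    using assms(3,6) by eventually_elim (use assms(2,5) in \<open>intro kl_term_nonneg; linarith\<close>)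
  have "integrable M (\<lambda>t. z t * ln (z t))"
    by (intro Linf_space_integrable Linf_space_mult Linf_space_ln[OF assms(4-6)] assms)
  moreover have "AE t in M. 0 \<le> z t" using assms(6) by eventually_elim (use assms(5) in simp)
  moreover have "(\<integral>\<^sup>+t. e2ennreal (kl_integrand (g t) (z t)) \<partial>M) = (\<integral>\<^sup>+t. ennreal (?k t) \<partial>M)"
  proof (rule nn_integral_cong_AE)
    show "AE t in M. e2ennreal (kl_integrand (g t) (z t)) = ennreal (?k t)"
      using assms(6) by eventually_elim (use assms(5) in \<open>simp add: kl_integrand_def\<close>)
  qed
  moreover have "\<dots> = ennreal (\<integral>t. ?k t \<partial>M)" by (rule nn_integral_eq_integral[OF k nn])
  moreover have "0 \<le> (\<integral>t. ?k t \<partial>M)" by (rule integral_nonneg_AE[OF nn])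
  ultimately show ?thesis by (simp add: KL_def)
qed

text \<open>
  A first-order upper bound with an explicit uniform remainder, so that the directional derivative
  of the integral can be taken without a convergence theorem.  It comes from
  \<open>ln (x / y) \<le> x / y - 1\<close> at \<open>y = x + s h\<close>, whose right-hand side is
  \<open>- s h / x + s\<^sup>2 h\<^sup>2 / (x y)\<close>; the restriction on \<open>s\<close> keeps \<open>y \<ge> c / 2\<close>.
\<close>

lemma kl_term_segment_le:
  fixes a x h s c H B :: real
  assumes "0 < a" "a \<le> B" "0 < c" "c \<le> x" "\<bar>h\<bar> \<le> H" "0 < s" "s * H \<le> c / 2"
  shows "a * ln (a / (x + s * h)) - a + (x + s * h)
           \<le> a * ln (a / x) - a + x + s * ((1 - a / x) * h) + s\<^sup>2 * (2 * B * H\<^sup>2 / c\<^sup>2)"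
proof -
  have sh: "\<bar>s * h\<bar> \<le> c / 2"
    using assms mult_left_mono[of "\<bar>h\<bar>" H s] unfolding abs_mult by linarith
  then have q: "c / 2 \<le> x + s * h" using assms by linarith
  have pos: "0 < x + s * h" "0 < x" using q assms by linarith+
  have "ln (x / (x + s * h)) \<le> x / (x + s * h) - 1" using pos by (intro ln_le_minus_one) auto
  also have "\<dots> = - s * h / x + s\<^sup>2 * h\<^sup>2 / (x * (x + s * h))"
    using pos by (simp add: divide_simps power2_eq_square) (simp add: algebra_simps)
  finally have "a * ln (x / (x + s * h)) \<le> a * (- s * h / x + s\<^sup>2 * h\<^sup>2 / (x * (x + s * h)))"
    using assms(1) by (intro mult_left_mono) auto
  also have "\<dots> = - s * (a / x * h) + s\<^sup>2 * (a * h\<^sup>2 / (x * (x + s * h)))"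
    by (simp add: algebra_simps)
  also have "\<dots> \<le> - s * (a / x * h) + s\<^sup>2 * (B * H\<^sup>2 / (c * (c / 2)))"
  proof (intro add_left_mono mult_left_mono frac_le)
    have "h\<^sup>2 \<le> H\<^sup>2" using assms(5) power_mono[of "\<bar>h\<bar>" H 2] by simp
    then show "a * h\<^sup>2 \<le> B * H\<^sup>2" using assms by (intro mult_mono) auto
    show "0 \<le> B * H\<^sup>2" using assms by simp
    show "c * (c / 2) \<le> x * (x + s * h)" using assms q by (intro mult_mono) auto
  qed (use assms in simp_all)
  also have "B * H\<^sup>2 / (c * (c / 2)) = 2 * B * H\<^sup>2 / c\<^sup>2"
    by (simp add: power2_eq_square)
  finally have "a * ln (x / (x + s * h)) \<le> - s * (a / x * h) + s\<^sup>2 * (2 * B * H\<^sup>2 / c\<^sup>2)" .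
  moreover have "ln (a / (x + s * h)) = ln (a / x) + ln (x / (x + s * h))"
    using pos assms(1) by (simp add: ln_div)
  ultimately show ?thesis by (simp add: algebra_simps)
qed

text \<open>
  The perturbed point is only required to agree with \<open>z + s h\<close> almost everywhere, since an operator
  that is linear up to null sets produces nothing better.
\<close>

lemma (in finite_measure) KL_segment_expansion:
  assumes g: "g \<in> Linf_space M" "b > 0" "AE t in M. b \<le> g t"
    and z: "z \<in> Linf_space M" "c > 0" "AE t in M. c \<le> z t"
    and h: "h \<in> Linf_space M"
  obtains C s\<^sub>0 k where "s\<^sub>0 > 0" "KL M g z = ereal k"
    "\<And>s y. \<lbrakk>0 < s; s < s\<^sub>0; y \<in> Linf_space M; AE t in M. y t = z t + s * h t\<rbrakk>
       \<Longrightarrow> KL M g y \<le> ereal (k + s * (\<integral>t. (1 - g t / z t) * h t \<partial>M) + s\<^sup>2 * C)"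
proof -
  obtain H where H: "H > 0" "AE t in M. \<bar>h t\<bar> \<le> H" by (rule Linf_space_boundE[OF h])
  obtain B where B: "B > 0" "AE t in M. \<bar>g t\<bar> \<le> B" by (rule Linf_space_boundE[OF g(1)])
  let ?k = "\<lambda>t. g t * ln (g t / z t) - g t + z t"
  let ?d = "\<lambda>t. (1 - g t / z t) * h t"
  let ?C = "2 * B * H\<^sup>2 / c\<^sup>2"
  have ik: "integrable M ?k" by (intro Linf_space_integrable KL_integrand_Linf[OF g z])
  have id: "integrable M ?d"
    by (intro Linf_space_integrable Linf_space_mult Linf_space_diff Linf_space_const
        Linf_space_divide[OF g(1) z] h)
  show ?thesis
  proof
    show "c / (2 * H) > 0" using z(2) H(1) by simp
    show "KL M g z = ereal (\<integral>t. ?k t \<partial>M)" by (rule KL_eq_integral[OF g z])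
    fix s y assume s: "0 < s" "s < c / (2 * H)" and y: "y \<in> Linf_space M"
      and eq: "AE t in M. y t = z t + s * h t"
    have sH: "s * H \<le> c / 2" using s H(1) by (simp add: field_simps)
    have le: "AE t in M. c / 2 \<le> y t"
      using eq z(3) H(2)
    proof eventually_elim
      case (elim t)
      have "\<bar>s * h t\<bar> \<le> s * H" using elim(3) s by (simp add: abs_mult)
      then show ?case using elim sH by linarith
    qed
    have iy: "integrable M (\<lambda>t. g t * ln (g t / y t) - g t + y t)"
      by (rule Linf_space_integrable, rule KL_integrand_Linf[OF g y _ le]) (use z in simp)
    have KLy: "KL M g y = ereal (\<integral>t. g t * ln (g t / y t) - g t + y t \<partial>M)"
      by (rule KL_eq_integral[OF g y _ le]) (use z in simp)
    have "(\<integral>t. g t * ln (g t / y t) - g t + y t \<partial>M) \<le> (\<integral>t. ?k t + s * ?d t + s\<^sup>2 * ?C \<partial>M)"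
    proof (rule integral_mono_AE[OF iy])
      show "integrable M (\<lambda>t. ?k t + s * ?d t + s\<^sup>2 * ?C)"
        by (intro Bochner_Integration.integrable_add ik integrable_mult_right id) simp
      show "AE t in M. g t * ln (g t / y t) - g t + y t \<le> ?k t + s * ?d t + s\<^sup>2 * ?C"
        using eq g(3) B(2) z(3) H(2)
      proof eventually_elim
        case (elim t)
        show ?case unfolding elim(1)
          by (rule kl_term_segment_le) (use elim g(2) z(2) s sH in auto)
      qed
    qed
    also have "\<dots> = (\<integral>t. ?k t + s * ?d t \<partial>M) + (\<integral>t. s\<^sup>2 * ?C \<partial>M)"
      by (intro Bochner_Integration.integral_add Bochner_Integration.integrable_add
          ik integrable_mult_right id) simp
    also have "(\<integral>t. ?k t + s * ?d t \<partial>M) = (\<integral>t. ?k t \<partial>M) + s * (\<integral>t. ?d t \<partial>M)"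
      by (simp only: Bochner_Integration.integral_add[OF ik integrable_mult_right[OF id]]
          integral_mult_right_zero)
    also have "(\<integral>t. s\<^sup>2 * ?C \<partial>M) = s\<^sup>2 * (?C * measure M (space M))"
      by (simp only: lebesgue_integral_const) simp
    finally show "KL M g y \<le> ereal ((\<integral>t. ?k t \<partial>M) + s * (\<integral>t. ?d t \<partial>M) + s\<^sup>2 * (?C * measure M (space M)))"
      by (simp only: KLy ereal_less_eq)
  qed
qed

section \<open>The optimality condition of the regularized problem\<close>

text \<open>
  Compare \<open>u\<close> with \<open>(1 - s) u + s w\<close>: convexity bounds the change of \<open>R\<close> by \<open>s (R w - R u)\<close>, and
  the expansion above bounds the change of the fidelity to first order.  Dividing by \<open>s\<close> and
  letting \<open>s\<close> tend to \<open>0\<close> leaves the derivative of the fidelity.  The fidelity stays finite on the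
  initial part of the segment, even where \<open>A w\<close> is negative, because \<open>A u \<ge> c\<close> and \<open>A w\<close> is bounded.
\<close>

lemma variational_inequality:
  assumes N: "finite_measure N"
    and A: "linear_operator M N A" and R: "convex_functional M R"
    and g: "g \<in> Linf_space N" "b > 0" "AE t in N. b \<le> g t"
    and "\<alpha> > 0"
    and min: "is_arg_min (\<lambda>w. ereal (1 / \<alpha>) * KL N g (A w) + R w) (\<lambda>w. w \<in> L1_space M) u"
    and z: "c > 0" "AE t in N. c \<le> A u t"
    and w: "w \<in> L1_space M" and Ru: "R u = ereal r" and Rw: "R w = ereal q"
  shows "r - q \<le> (\<integral>t. (1 - g t / A u t) * (A w t - A u t) \<partial>N) / \<alpha>"
proof -
  have u: "u \<in> L1_space M" using min by (simp add: is_arg_min_def)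
  have AL: "A v \<in> Linf_space N" if "v \<in> L1_space M" for v
    using A that by (simp add: linear_operator_def)
  let ?h = "\<lambda>t. A w t - A u t"
  let ?D = "\<integral>t. (1 - g t / A u t) * ?h t \<partial>N"
  obtain C s\<^sub>0 k where s0: "s\<^sub>0 > 0" and k: "KL N g (A u) = ereal k"
    and ex: "\<And>s y. \<lbrakk>0 < s; s < s\<^sub>0; y \<in> Linf_space N; AE t in N. y t = A u t + s * ?h t\<rbrakk>
       \<Longrightarrow> KL N g y \<le> ereal (k + s * ?D + s\<^sup>2 * C)"
    by (rule finite_measure.KL_segment_expansion[OF N g AL[OF u] z Linf_space_diff[OF AL[OF w] AL[OF u]]])
       blast
  have step: "r - q \<le> ?D / \<alpha> + s * (C / \<alpha>)" if s: "0 < s" "s < min s\<^sub>0 1" for s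
  proof -
    let ?v = "\<lambda>x. (1 - s) * u x + s * w x"
    have v: "?v \<in> L1_space M" using u w by (simp add: L1_space_def)
    have "AE t in N. A ?v t = (1 - s) * A u t + s * A w t"
      using A u w unfolding linear_operator_def by blast
    then have "AE t in N. A ?v t = A u t + s * ?h t"
      by eventually_elim (simp add: algebra_simps)
    then have KLv: "KL N g (A ?v) \<le> ereal (k + s * ?D + s\<^sup>2 * C)"
      using s by (intro ex AL v) auto
    have Rv: "R ?v \<le> ereal ((1 - s) * r + s * q)"
    proof -
      have "R ?v \<le> ereal (1 - s) * R u + ereal s * R w"
        using R u w s unfolding convex_functional_def by simp
      then show ?thesis by (simp add: Ru Rw)
    qed
    have "ereal (k / \<alpha> + r) = ereal (1 / \<alpha>) * KL N g (A u) + R u" by (simp add: k Ru)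
    also have "\<dots> \<le> ereal (1 / \<alpha>) * KL N g (A ?v) + R ?v"
      using min v unfolding is_arg_min_def by (meson not_le)
    also have "\<dots> \<le> ereal (1 / \<alpha>) * ereal (k + s * ?D + s\<^sup>2 * C) + ereal ((1 - s) * r + s * q)"
      using \<open>\<alpha> > 0\<close> by (intro add_mono ereal_mult_left_mono KLv Rv) simp
    finally have "k / \<alpha> + r \<le> (k + s * ?D + s\<^sup>2 * C) / \<alpha> + ((1 - s) * r + s * q)" by simp
    then have "s * (r - q) \<le> s * (?D / \<alpha> + s * (C / \<alpha>))"
      by (simp add: algebra_simps add_divide_distrib power2_eq_square)
    then show ?thesis using s(1) by (simp only: mult_le_cancel_left_pos)
  qed
  show ?thesis
  proof (rule tendsto_lowerbound)
    have "((\<lambda>s. ?D / \<alpha> + s * (C / \<alpha>)) \<longlongrightarrow> ?D / \<alpha> + 0 * (C / \<alpha>)) (at_right 0)"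
      by (intro tendsto_intros)
    then show "((\<lambda>s. ?D / \<alpha> + s * (C / \<alpha>)) \<longlongrightarrow> ?D / \<alpha>) (at_right 0)" by simp
    show "\<forall>\<^sub>F s in at_right 0. r - q \<le> ?D / \<alpha> + s * (C / \<alpha>)"
      unfolding eventually_at_right_field using s0 by (intro exI[of _ "min s\<^sub>0 1"] conjI allI impI step) auto
  qed simp
qed

section \<open>The pointwise estimate\<close>

text \<open>
  With \<open>X\<close>, \<open>Q\<close> and \<open>s\<close> as in the proof, the left-hand side is \<open>(X Q - (1 + s) X\<^sup>2) / (z \<alpha>)\<close>.
  Since \<open>1 + s \<ge> 1 / 2\<close>, Young's inequality leaves at most \<open>Q\<^sup>2 / 2 \<le> (f - g)\<^sup>2 + (f s\<^sup>2)\<^sup>2\<close> in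
  the numerator; the stated form follows by \<open>1 / m \<le> 1 / (2 m / 3)\<close>.
\<close>

lemma residual_product_le:
  fixes f g z p \<alpha> \<delta> m :: real
  assumes "\<alpha> > 0" "m > 0" "m \<le> z" "\<bar>\<alpha> * p\<bar> \<le> 1 / 2" "\<bar>f - g\<bar> \<le> \<delta>"
  shows "(1 - g / z) * ((f - \<alpha> * (f * p)) - z) / \<alpha> + p * ((f - \<alpha> * (f * p)) - z)
    \<le> \<delta>\<^sup>2 / \<alpha> * (1 / (2 * m / 3)) + \<alpha> * \<delta>\<^sup>2 * (p\<^sup>2 / (2 * m / 3))
      + \<alpha> ^ 3 * ((f * p\<^sup>2)\<^sup>2 / (2 * m / 3)) + \<alpha> ^ 3 * \<delta>\<^sup>2 * ((p\<^sup>2)\<^sup>2 / (2 * m / 3))"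
proof -
  define s e X where "s = \<alpha> * p" and "e = f - g" and "X = f - \<alpha> * (f * p) - z"
  \<comment> \<open>The value of \<open>z (1 + s) - g\<close> when \<open>X = 0\<close>.\<close>
  define Q where "Q = e - f * s\<^sup>2"
  have z: "z > 0" using assms by linarith
  have s: "1 / 2 \<le> 1 + s" using assms(4) by (simp add: s_def)
  have "(1 - g / z) * X / \<alpha> + p * X = (X * Q - (1 + s) * X\<^sup>2) / z / \<alpha>"
    using z assms(1) unfolding Q_def X_def e_def s_def
    by (simp add: divide_simps) (simp add: algebra_simps power2_eq_square)
  also have "\<dots> \<le> ((e\<^sup>2 + (f * s\<^sup>2)\<^sup>2) / m) / \<alpha>"
  proof (intro divide_right_mono)
    have "0 \<le> (X - Q)\<^sup>2" by simp
    then have "X * Q - X\<^sup>2 / 2 \<le> Q\<^sup>2 / 2" by (simp add: power2_eq_square algebra_simps)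
    moreover have "X\<^sup>2 / 2 \<le> (1 + s) * X\<^sup>2" using mult_right_mono[OF s, of "X\<^sup>2"] by simp
    moreover have "Q\<^sup>2 / 2 \<le> e\<^sup>2 + (f * s\<^sup>2)\<^sup>2"
    proof -
      have "0 \<le> (e + f * s\<^sup>2)\<^sup>2" by simp
      then show ?thesis unfolding Q_def by (simp add: power2_diff power2_sum)
    qed
    ultimately have "X * Q - (1 + s) * X\<^sup>2 \<le> e\<^sup>2 + (f * s\<^sup>2)\<^sup>2" by linarith
    then have "(X * Q - (1 + s) * X\<^sup>2) / z \<le> (e\<^sup>2 + (f * s\<^sup>2)\<^sup>2) / z"
      using z by (intro divide_right_mono) auto
    also have "\<dots> \<le> (e\<^sup>2 + (f * s\<^sup>2)\<^sup>2) / m" using assms by (intro divide_left_mono) auto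
    finally show "(X * Q - (1 + s) * X\<^sup>2) / z \<le> (e\<^sup>2 + (f * s\<^sup>2)\<^sup>2) / m" .
  qed (use assms in simp)
  also have "\<dots> \<le> ((\<delta>\<^sup>2 + \<alpha>\<^sup>2 * \<delta>\<^sup>2 * p\<^sup>2 + (f * s\<^sup>2)\<^sup>2 + \<alpha> ^ 4 * \<delta>\<^sup>2 * (p\<^sup>2)\<^sup>2) / (2 * m / 3)) / \<alpha>"
  proof (intro divide_right_mono frac_le)
    have "e\<^sup>2 \<le> \<delta>\<^sup>2" using power_mono[OF assms(5), of 2] by (simp add: e_def)
    then show "e\<^sup>2 + (f * s\<^sup>2)\<^sup>2 \<le> \<delta>\<^sup>2 + \<alpha>\<^sup>2 * \<delta>\<^sup>2 * p\<^sup>2 + (f * s\<^sup>2)\<^sup>2 + \<alpha> ^ 4 * \<delta>\<^sup>2 * (p\<^sup>2)\<^sup>2"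
      by (simp add: add_increasing2)
  qed (use assms in auto)
  also have "\<dots> = \<delta>\<^sup>2 / \<alpha> * (1 / (2 * m / 3)) + \<alpha> * \<delta>\<^sup>2 * (p\<^sup>2 / (2 * m / 3))
      + \<alpha> ^ 3 * ((f * p\<^sup>2)\<^sup>2 / (2 * m / 3)) + \<alpha> ^ 3 * \<delta>\<^sup>2 * ((p\<^sup>2)\<^sup>2 / (2 * m / 3))"
    using assms(1,2) unfolding s_def
    by (simp add: divide_simps) (simp add: algebra_simps eval_nat_numeral)
  finally show ?thesis unfolding X_def .
qed

section \<open>The Bregman distance estimate\<close>

lemma linear_operator_diff:
  assumes "linear_operator M N A" "u \<in> L1_space M" "w \<in> L1_space M"
  shows "AE t in N. A (\<lambda>x. u x - a * w x) t = A u t - a * A w t"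
proof -
  have "AE t in N. A (\<lambda>x. 1 * u x + (- a) * w x) t = 1 * A u t + (- a) * A w t"
    using assms unfolding linear_operator_def by blast
  then show ?thesis by simp
qed

lemma adjoint_dual_of_diff:
  assumes A: "linear_operator M N A" and u: "u \<in> L1_space M" and w: "w \<in> L1_space M"
    and p: "p \<in> Linf_space N"
  shows "adjoint_operator A (dual_of N p) (\<lambda>x. u x - w x) = (\<integral>t. p t * (A u t - A w t) \<partial>N)"
  unfolding adjoint_operator_def dual_of_def
proof (rule integral_cong_AE)
  have "(\<lambda>x. u x - w x) \<in> L1_space M" using u w by (simp add: L1_space_def)
  then have "A u \<in> Linf_space N" "A w \<in> Linf_space N" "A (\<lambda>x. u x - w x) \<in> Linf_space N"
    using A u w by (simp_all add: linear_operator_def)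
  then show "(\<lambda>t. p t * A (\<lambda>x. u x - w x) t) \<in> borel_measurable N"
    "(\<lambda>t. p t * (A u t - A w t)) \<in> borel_measurable N"
    using p by (auto intro!: borel_measurable_times borel_measurable_diff dest!: Linf_space_measurable)
  show "AE t in N. p t * A (\<lambda>x. u x - w x) t = p t * (A u t - A w t)"
    using linear_operator_diff[OF A u w, of 1] by eventually_elim simp
qed

lemma L2_norm_power2: "(L2_norm M z)\<^sup>2 = (\<integral>t. (z t)\<^sup>2 \<partial>M)"
  by (simp add: L2_norm_def)

text \<open>
  The estimate for one fixed pair \<open>\<alpha>\<close>, \<open>\<delta>\<close>.  The element \<open>u\<^sub>0\<close> at which the objective is finite
  makes \<open>R u\<^sup>\<dagger>\<close> and \<open>R u\<close> real numbers, the former through the subgradient inequality and the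
  latter through minimality; only \<open>R\<close> at the comparison element may be infinite, and then so is
  the right-hand side.
\<close>

lemma bregman_distance_le:
  assumes N: "finite_measure N"
    and A: "linear_operator M N A" and R: "proper_functional M R" "convex_functional M R"
    and f: "f \<in> Linf_space N"
    and g: "g \<in> Linf_space N" "b > 0" "AE t in N. b \<le> g t" "Linf_norm N (\<lambda>t. f t - g t) \<le> \<delta>"
    and \<alpha>: "\<alpha> > 0"
    and min: "is_arg_min (\<lambda>w. ereal (1 / \<alpha>) * KL N g (A w) + R w) (\<lambda>w. w \<in> L1_space M) u"
    and u0: "u0 \<in> L1_space M" "KL N g (A u0) < \<infinity>" "R u0 < \<infinity>"
    and ud: "ud \<in> L1_space M" "AE t in N. A ud t = f t"
    and p: "p \<in> Linf_space N" "AE t in N. \<bar>\<alpha> * p t\<bar> \<le> 1 / 2"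
    and sub: "adjoint_operator A (dual_of N p) \<in> subdifferential M R ud"
    and v: "v \<in> L1_space M" "AE t in N. f t * p t = A v t"
    and m: "m > 0" "AE t in N. m \<le> A u t"
  defines "\<xi> \<equiv> adjoint_operator A (dual_of N p)" and "\<gamma> \<equiv> 2 * m / 3"
  shows "bregman R \<xi> u ud \<le> bregman R \<xi> (\<lambda>x. ud x - \<alpha> * v x) ud
           + ereal (\<delta>\<^sup>2 / \<alpha> * (measure N (space N) / \<gamma>)
                    + \<alpha> * \<delta>\<^sup>2 * ((L2_norm N p)\<^sup>2 / \<gamma>)
                    + \<alpha> ^ 3 * ((L2_norm N (\<lambda>t. f t * (p t)\<^sup>2))\<^sup>2 / \<gamma>)
                    + \<alpha> ^ 3 * \<delta>\<^sup>2 * ((L2_norm N (\<lambda>t. (p t)\<^sup>2))\<^sup>2 / \<gamma>))"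
proof -
  interpret finite_measure N by (rule N)
  let ?w = "\<lambda>x. ud x - \<alpha> * v x"
  have u: "u \<in> L1_space M" using min by (simp add: is_arg_min_def)
  have w: "?w \<in> L1_space M" using ud v by (simp add: L1_space_def)
  have AL: "A x \<in> Linf_space N" if "x \<in> L1_space M" for x
    using A that by (simp add: linear_operator_def)
  have notminf: "R x \<noteq> - \<infinity>" if "x \<in> L1_space M" for x
    using R(1) that unfolding proper_functional_def by blast
  obtain d where d: "R ud = ereal d"
  proof -
    have "R ud + ereal (adjoint_operator A (dual_of N p) (\<lambda>x. u0 x - ud x)) \<le> R u0"
      using sub u0(1) unfolding subdifferential_def by blast
    then have "R ud \<noteq> \<infinity>" using u0(3) by auto
    then show ?thesis using that notminf[OF ud(1)] by (cases "R ud") auto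
  qed
  obtain r where r: "R u = ereal r"
  proof -
    have "ereal (1 / \<alpha>) * KL N g (A u) + R u \<le> ereal (1 / \<alpha>) * KL N g (A u0) + R u0"
      using min u0(1) unfolding is_arg_min_def by (meson not_le)
    also have "\<dots> < \<infinity>"
    proof -
      have "ereal (1 / \<alpha>) * KL N g (A u0) < \<infinity>"
        using u0(2) \<alpha> by (cases "KL N g (A u0)") auto
      then show ?thesis using u0(3) by simp
    qed
    finally have "R u \<noteq> \<infinity>" by auto
    then show ?thesis using that notminf[OF u] by (cases "R u") auto
  qed
  show ?thesis
  proof (cases "R ?w = \<infinity>")
    case True
    then show ?thesis by (simp add: bregman_def d)
  next
    case False
    then obtain q where q: "R ?w = ereal q" using notminf[OF w] by (cases "R ?w") auto
    let ?h = "\<lambda>t. A ?w t - A u t"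
    let ?dk = "\<lambda>t. (1 - g t / A u t) * ?h t"
    have opt: "r - q \<le> (\<integral>t. ?dk t \<partial>N) / \<alpha>"
      by (rule variational_inequality[where A = A and R = R and u = u and w = ?w, OF N A R(2) g(1-3) \<alpha> min m w r q])
    have hL: "?h \<in> Linf_space N" by (intro Linf_space_diff AL u w)
    have idk: "integrable N ?dk"
      by (intro Linf_space_integrable Linf_space_mult Linf_space_diff Linf_space_const
          Linf_space_divide[OF g(1) AL[OF u] m] hL)
    have iph: "integrable N (\<lambda>t. p t * ?h t)"
      by (intro Linf_space_integrable Linf_space_mult p hL)
    have ipx: "integrable N (\<lambda>t. p t * (A x t - A ud t))" if "x \<in> L1_space M" for x
      by (intro Linf_space_integrable Linf_space_mult Linf_space_diff p AL that ud)
    let ?P = "\<lambda>t. (p t)\<^sup>2" and ?F = "\<lambda>t. (f t * (p t)\<^sup>2)\<^sup>2" and ?Q = "\<lambda>t. ((p t)\<^sup>2)\<^sup>2"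
    have iP: "integrable N ?P" and iF: "integrable N ?F" and iQ: "integrable N ?Q"
      by (intro Linf_space_integrable Linf_space_intros p f)+
    let ?B = "\<lambda>t. \<delta>\<^sup>2 / \<alpha> * (1 / \<gamma>) + \<alpha> * \<delta>\<^sup>2 * (?P t / \<gamma>) + \<alpha> ^ 3 * (?F t / \<gamma>)
               + \<alpha> ^ 3 * \<delta>\<^sup>2 * (?Q t / \<gamma>)"
    have iB: "integrable N ?B"
      by (intro Bochner_Integration.integrable_add integrable_mult_right integrable_divide iP iF iQ)
         simp_all
    have "\<xi> (\<lambda>x. ?w x - ud x) - \<xi> (\<lambda>x. u x - ud x) = (\<integral>t. p t * ?h t \<partial>N)"
    proof -
      have "\<xi> (\<lambda>x. ?w x - ud x) - \<xi> (\<lambda>x. u x - ud x)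
          = (\<integral>t. p t * (A ?w t - A ud t) - p t * (A u t - A ud t) \<partial>N)"
        unfolding \<xi>_def adjoint_dual_of_diff[OF A w ud(1) p(1)] adjoint_dual_of_diff[OF A u ud(1) p(1)]
        by (rule Bochner_Integration.integral_diff[symmetric]) (intro ipx w u)+
      also have "\<dots> = (\<integral>t. p t * ?h t \<partial>N)"
        by (rule Bochner_Integration.integral_cong) (simp_all add: algebra_simps)
      finally show ?thesis .
    qed
    then have "(r - d - \<xi> (\<lambda>x. u x - ud x)) - (q - d - \<xi> (\<lambda>x. ?w x - ud x))
        \<le> (\<integral>t. ?dk t \<partial>N) / \<alpha> + (\<integral>t. p t * ?h t \<partial>N)"
      using opt by linarith
    also have "\<dots> = (\<integral>t. ?dk t / \<alpha> + p t * ?h t \<partial>N)"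
      by (simp only: Bochner_Integration.integral_add[OF integrable_divide[OF idk] iph]
          integral_divide_zero)
    also have "\<dots> \<le> (\<integral>t. ?B t \<partial>N)"
    proof (rule integral_mono_AE[OF _ iB])
      show "integrable N (\<lambda>t. ?dk t / \<alpha> + p t * ?h t)"
        by (intro Bochner_Integration.integrable_add integrable_divide idk iph)
      have "AE t in N. \<bar>f t - g t\<bar> \<le> Linf_norm N (\<lambda>t. f t - g t)"
        by (intro AE_abs_le_Linf_norm Linf_space_diff f g)
      then show "AE t in N. ?dk t / \<alpha> + p t * ?h t \<le> ?B t"
        using linear_operator_diff[OF A ud(1) v(1), of \<alpha>] ud(2) v(2) p(2) m(2)
      proof eventually_elim
        case (elim t)
        have "A ?w t = f t - \<alpha> * (f t * p t)" using elim by simp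
        then show ?case unfolding \<gamma>_def
          using residual_product_le[OF \<alpha> m(1) elim(6) elim(5), of "f t" "g t" \<delta>] elim(1) g(4) by simp
      qed
    qed
    also have "\<dots> = \<delta>\<^sup>2 / \<alpha> * (measure N (space N) / \<gamma>) + \<alpha> * \<delta>\<^sup>2 * ((L2_norm N p)\<^sup>2 / \<gamma>)
        + \<alpha> ^ 3 * ((L2_norm N (\<lambda>t. f t * (p t)\<^sup>2))\<^sup>2 / \<gamma>)
        + \<alpha> ^ 3 * \<delta>\<^sup>2 * ((L2_norm N (\<lambda>t. (p t)\<^sup>2))\<^sup>2 / \<gamma>)"
      using iP iF iQ by (simp add: L2_norm_power2)
    finally show ?thesis by (simp add: bregman_def d r q)
  qed
qed

theorem theorem5p3:
  fixes \<Omega> \<Gamma> :: "(real^2) set"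
    and A :: "(real^2 \<Rightarrow> real) \<Rightarrow> (real^2 \<Rightarrow> real)"
    and R :: "(real^2 \<Rightarrow> real) \<Rightarrow> ereal"
    and f :: "real^2 \<Rightarrow> real"
    and fn :: "real \<Rightarrow> (real^2 \<Rightarrow> real)"
    and u :: "real \<Rightarrow> real \<Rightarrow> (real^2 \<Rightarrow> real)"
    and ud vd pd :: "real^2 \<Rightarrow> real"
    and C1 C2 m :: real
  defines "MO \<equiv> lebesgue_on \<Omega>" and "MG \<equiv> lebesgue_on \<Gamma>"
    and "\<xi> \<equiv> adjoint_operator A (dual_of (lebesgue_on \<Gamma>) pd)"
    and "\<gamma> \<equiv> 2 * m / 3"
  assumes "bounded \<Omega>" and "\<Omega> \<in> sets lebesgue"
    and "bounded \<Gamma>" and "\<Gamma> \<in> sets lebesgue"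
    and "linear_operator MO MG A" and "compact_operator MO MG A" and "\<not> well_posed MO MG A"
    and "f \<in> Linf_space MG"
    and "C1 > 0" and "C2 > 0"
    and "\<And>\<delta>. \<delta> > 0 \<Longrightarrow> fn \<delta> \<in> Linf_space MG"
    and "\<And>\<delta>. \<delta> > 0 \<Longrightarrow> AE t in MG. 0 \<le> fn \<delta> t"
    and "\<And>\<delta>. \<delta> > 0 \<Longrightarrow> Linf_norm MG (\<lambda>t. f t - fn \<delta> t) \<le> \<delta>"
    and "\<And>\<delta>. \<delta> > 0 \<Longrightarrow> AE t in MG. C1 < fn \<delta> t \<and> fn \<delta> t < C2"
    and "proper_functional MO R" and "convex_functional MO R" and "lsc_functional MO R"
    and "is_arg_min R (\<lambda>w. w \<in> L1_space MO \<and> (AE t in MG. A w t = f t)) ud"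
    and "\<And>\<alpha> \<delta>. \<alpha> > 0 \<Longrightarrow> \<delta> > 0 \<Longrightarrow>
           is_arg_min (\<lambda>w. ereal (1 / \<alpha>) * KL MG (fn \<delta>) (A w) + R w) (\<lambda>w. w \<in> L1_space MO) (u \<alpha> \<delta>)"
    and "\<And>\<delta>. \<delta> > 0 \<Longrightarrow>
           \<exists>u0\<in>L1_space MO. KL MG (fn \<delta>) (A u0) < \<infinity> \<and> R u0 < \<infinity> \<and>
             topcontinuous_at (Linf_top MG) euclidean (KL MG (fn \<delta>)) (A u0)"
    and "pd \<in> Linf_space MG" and "vd \<in> L1_space MO"
    and "\<xi> \<in> subdifferential MO R ud"
    and "AE t in MG. f t * pd t = A vd t"
    and "\<And>\<alpha> \<delta>. \<alpha> > 0 \<Longrightarrow> \<delta> > 0 \<Longrightarrow> A (u \<alpha> \<delta>) \<in> E_set MG"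
    and "m > 0"
    and "\<exists>\<epsilon>>0. ereal m \<le> Inf {essinf MG (A (u \<alpha> \<delta>)) | \<alpha> \<delta>. 0 < \<alpha> \<and> \<alpha> < \<epsilon> \<and> 0 < \<delta> \<and> \<delta> < \<epsilon>}"
  shows "\<exists>\<epsilon>>0. \<forall>\<alpha> \<delta>. 0 < \<alpha> \<and> \<alpha> < \<epsilon> \<and> 0 < \<delta> \<and> \<delta> < \<epsilon> \<longrightarrow>
           bregman R \<xi> (u \<alpha> \<delta>) ud
             \<le> bregman R \<xi> (\<lambda>x. ud x - \<alpha> * vd x) ud
               + ereal (\<delta>\<^sup>2 / \<alpha> * (measure lebesgue \<Gamma> / \<gamma>)
                        + \<alpha> * \<delta>\<^sup>2 * ((L2_norm MG pd)\<^sup>2 / \<gamma>)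
                        + \<alpha> ^ 3 * ((L2_norm MG (\<lambda>t. f t * (pd t)\<^sup>2))\<^sup>2 / \<gamma>)
                        + \<alpha> ^ 3 * \<delta>\<^sup>2 * ((L2_norm MG (\<lambda>t. (pd t)\<^sup>2))\<^sup>2 / \<gamma>))"
proof -
  have fin: "finite_measure MG"
    unfolding MG_def by (intro finite_measure_lebesgue_on bounded_set_imp_lmeasurable assms)
  have meas: "measure MG (space MG) = measure lebesgue \<Gamma>"
    unfolding MG_def using \<open>\<Gamma> \<in> sets lebesgue\<close> by (simp add: measure_restrict_space)
  obtain P where P: "P > 0" "AE t in MG. \<bar>pd t\<bar> \<le> P"
    by (rule Linf_space_boundE[OF \<open>pd \<in> Linf_space MG\<close>])
  obtain e where e: "e > 0"
    "ereal m \<le> Inf {essinf MG (A (u \<alpha> \<delta>)) | \<alpha> \<delta>. 0 < \<alpha> \<and> \<alpha> < e \<and> 0 < \<delta> \<and> \<delta> < e}"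
    using \<open>\<exists>\<epsilon>>0. ereal m \<le> Inf _\<close> by blast
  show ?thesis
  proof (intro exI[of _ "min e (1 / (2 * P))"] conjI allI impI)
    show "0 < min e (1 / (2 * P))" using e P by simp
    fix \<alpha> \<delta> :: real
    assume *: "0 < \<alpha> \<and> \<alpha> < min e (1 / (2 * P)) \<and> 0 < \<delta> \<and> \<delta> < min e (1 / (2 * P))"
    then have \<alpha>: "\<alpha> > 0" and \<delta>: "\<delta> > 0" by auto
    have "Inf {essinf MG (A (u \<alpha> \<delta>)) | \<alpha> \<delta>. 0 < \<alpha> \<and> \<alpha> < e \<and> 0 < \<delta> \<and> \<delta> < e}
        \<le> essinf MG (A (u \<alpha> \<delta>))"
      by (rule Inf_lower) (use * in auto)
    then have m: "AE t in MG. m \<le> A (u \<alpha> \<delta>) t" using e(2) by (intro AE_essinf_le) auto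
    have p: "AE t in MG. \<bar>\<alpha> * pd t\<bar> \<le> 1 / 2"
      using P(2)
    proof eventually_elim
      case (elim t)
      have "\<alpha> * \<bar>pd t\<bar> \<le> 1 / (2 * P) * P" using elim * by (intro mult_mono) auto
      then show ?case using \<alpha> P(1) by (simp add: abs_mult)
    qed
    have ud: "ud \<in> L1_space MO" "AE t in MG. A ud t = f t"
      using \<open>is_arg_min R _ ud\<close> by (simp_all add: is_arg_min_def)
    have g: "AE t in MG. C1 \<le> fn \<delta> t"
      using \<open>\<And>\<delta>. \<delta> > 0 \<Longrightarrow> AE t in MG. C1 < fn \<delta> t \<and> fn \<delta> t < C2\<close>[OF \<delta>]
      by eventually_elim simp
    obtain u0 where u0: "u0 \<in> L1_space MO" "KL MG (fn \<delta>) (A u0) < \<infinity>" "R u0 < \<infinity>"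
      using \<open>\<And>\<delta>. \<delta> > 0 \<Longrightarrow> \<exists>u0\<in>L1_space MO. KL MG (fn \<delta>) (A u0) < \<infinity> \<and> R u0 < \<infinity> \<and>
             topcontinuous_at (Linf_top MG) euclidean (KL MG (fn \<delta>)) (A u0)\<close>[OF \<delta>] by blast
    have sub: "adjoint_operator A (dual_of MG pd) \<in> subdifferential MO R ud"
      using \<open>\<xi> \<in> subdifferential MO R ud\<close> by (simp add: \<xi>_def MG_def)
    show "bregman R \<xi> (u \<alpha> \<delta>) ud
             \<le> bregman R \<xi> (\<lambda>x. ud x - \<alpha> * vd x) ud
               + ereal (\<delta>\<^sup>2 / \<alpha> * (measure lebesgue \<Gamma> / \<gamma>)
                        + \<alpha> * \<delta>\<^sup>2 * ((L2_norm MG pd)\<^sup>2 / \<gamma>)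
                        + \<alpha> ^ 3 * ((L2_norm MG (\<lambda>t. f t * (pd t)\<^sup>2))\<^sup>2 / \<gamma>)
                        + \<alpha> ^ 3 * \<delta>\<^sup>2 * ((L2_norm MG (\<lambda>t. (pd t)\<^sup>2))\<^sup>2 / \<gamma>))"
      using bregman_distance_le[where R = R and A = A and u = "u \<alpha> \<delta>" and g = "fn \<delta>"
            and f = f and p = pd and ud = ud and v = vd,
          OF fin \<open>linear_operator MO MG A\<close> \<open>proper_functional MO R\<close>
          \<open>convex_functional MO R\<close> \<open>f \<in> Linf_space MG\<close>
          \<open>\<And>\<delta>. \<delta> > 0 \<Longrightarrow> fn \<delta> \<in> Linf_space MG\<close>[OF \<delta>] \<open>C1 > 0\<close> g
          \<open>\<And>\<delta>. \<delta> > 0 \<Longrightarrow> Linf_norm MG (\<lambda>t. f t - fn \<delta> t) \<le> \<delta>\<close>[OF \<delta>] \<alpha>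
          \<open>\<And>\<alpha> \<delta>. \<alpha> > 0 \<Longrightarrow> \<delta> > 0 \<Longrightarrow>
             is_arg_min (\<lambda>w. ereal (1 / \<alpha>) * KL MG (fn \<delta>) (A w) + R w)
               (\<lambda>w. w \<in> L1_space MO) (u \<alpha> \<delta>)\<close>[OF \<alpha> \<delta>]
          u0 ud \<open>pd \<in> Linf_space MG\<close> p sub \<open>vd \<in> L1_space MO\<close>
          \<open>AE t in MG. f t * pd t = A vd t\<close> \<open>m > 0\<close> m]
      unfolding meas[unfolded MG_def] \<xi>_def \<gamma>_def MG_def .
  qed
qed

end
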